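(* Let $n \geq 3$ be an integer with $n \neq 7$. Then $n$ and $n+2$ are both prime (i.e. they are twin primes) if and only if the integer $4(n-3)! + 2 + n$ is divisible by $n$ but not divisible by $n+2$. The equivalence fails for $n = 7$: there $4(n-3)!+2+n$ is divisible by $n$ but not by $n+2$, yet $n+2$ is not prime. *)

theory Defs
  imports Complex_Main "HOL-Computational_Algebra.Primes"
begin

end

theory Submission
  imports Defs "HOL-Number_Theory.Residues"
begin

text \<open>
  Since \<open>(n - 1) (n - 2)\<close> is \<open>2\<close> modulo \<open>n\<close>, Wilson's theorem shows that an odd prime \<open>n\<close>
  divides \<open>4 (n - 3)! + 2\<close>. If a composite \<open>n\<close> did, then each of its prime factors would divide
  both \<open>(n - 3)!\<close> and \<open>2\<close>, so \<open>n\<close> would be a multiple of \<open>4\<close>, which is absurd modulo \<open>4\<close>.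
  For \<open>m = n + 2\<close> the number in question is \<open>4 (m - 5)! + m\<close>; an odd \<open>m\<close> divides it iff \<open>m\<close>
  divides \<open>(m - 5)!\<close>, which fails for primes and holds for every odd composite \<open>m\<close> other than \<open>9\<close>.
\<close>

text \<open>The factors \<open>a\<close> and \<open>b\<close> occur separately in the product:
  \<open>a\<close> already divides \<open>fact (b - 1)\<close>, and \<open>b\<close> is the next
  factor.\<close>

lemma mult_dvd_fact:
  fixes a b k :: nat
  assumes "0 < a" "a < b" "b \<le> k"
  shows "a * b dvd fact k"
proof -
  have "a dvd fact (b - 1)"
    using assms by (intro dvd_fact) auto
  then have "a * b dvd fact (b - 1) * b"
    by (rule mult_dvd_mono) simp
  also have "fact (b - 1) * b = fact b"
    using assms by (simp add: fact_reduce mult.commute)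
  also have "fact b dvd (fact k :: nat)"
    using assms by (intro fact_dvd)
  finally show ?thesis .
qed

text \<open>Two distinct proper factors of \<open>m\<close> both occur in the factorial. If
  \<open>m\<close> is a square of \<open>a\<close>, then \<open>a\<close> and \<open>2 * a\<close>
  serve instead; this needs \<open>2 * a \<le> m - 5\<close>, which fails for
  \<open>a = 3\<close>.\<close>

lemma odd_composite_dvd_fact:
  fixes m :: nat
  assumes "odd m" "1 < m" "\<not> prime m" "m \<noteq> 9"
  shows "m dvd fact (m - 5)"
proof -
  obtain a b where ab: "m = a * b" "1 < a" "1 < b" "a \<le> b"
  proof -
    obtain a where a: "a dvd m" "a \<noteq> 1" "a \<noteq> m"
      using assms by (auto simp: prime_nat_iff)
    then obtain b where b: "m = a * b" by blast
    have "1 < a" "1 < b"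
      using a b \<open>1 < m\<close> by (auto intro!: Suc_lessI intro: Nat.gr0I)
    then show ?thesis
      using b that[of a b] that[of b a] by (metis mult.commute nat_le_linear)
  qed
  then have "odd a" "odd b" using assms by auto
  then have "a \<noteq> 2" "b \<noteq> 2" by auto
  then have a3: "3 \<le> a" "3 \<le> b" using ab by auto
  show ?thesis
  proof (cases "a < b")
    case True
    have "3 * b \<le> m" using ab a3 by simp
    then have "b \<le> m - 5" using a3 by linarith
    then show ?thesis using True ab by (simp add: mult_dvd_fact)
  next
    case False
    then have eq: "a = b" using ab by simp
    have "a \<noteq> 3" using eq ab assms by auto
    moreover have "a \<noteq> 4" using \<open>odd a\<close> by auto
    ultimately have "5 \<le> a" using a3 by simp
    then have "5 * a \<le> m" using ab eq by simp
    then have "2 * a \<le> m - 5" using \<open>5 \<le> a\<close> by linarith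
    then have "a * (2 * a) dvd fact (m - 5)"
      using ab by (intro mult_dvd_fact) auto
    moreover have "m dvd a * (2 * a)" using ab eq by simp
    ultimately show ?thesis by (rule dvd_trans[rotated])
  qed
qed

lemma prime_dvd_four_fact:
  fixes n :: nat
  assumes "prime n" "3 \<le> n"
  shows "n dvd 4 * fact (n - 3) + 2"
proof -
  obtain k where k: "n = k + 3" using assms(2) by (metis le_add_diff_inverse2)
  have "[fact (n - 1) = -1] (mod int n)"
    using assms(1) by (rule wilson_theorem)
  then have "int n dvd fact (k + 2) + 1"
    by (simp add: cong_iff_dvd_diff k)
  \<comment> \<open>As \<open>n = k + 3\<close>, the product \<open>(k + 1) * (k + 2)\<close> equals
    \<open>k * n + 2\<close>.\<close>
  also have "(fact (k + 2) :: int) + 1 = int n * (int k * fact k) + (2 * fact k + 1)"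
    by (simp add: k algebra_simps)
  finally have "int n dvd 2 * fact k + 1"
    using dvd_add_right_iff[of "int n" "int n * (int k * fact k)"] by simp
  then have "int n dvd 2 * (2 * fact k + 1)" by (rule dvd_mult)
  also have "2 * (2 * fact k + 1) = int (4 * fact k + 2)" by simp
  finally show ?thesis by (simp only: int_dvd_int_iff k add_diff_cancel_right')
qed

lemma prime_if_dvd_four_fact:
  fixes n :: nat
  assumes "3 \<le> n" and dvd: "n dvd 4 * fact (n - 3) + 2"
  shows "prime n"
proof (rule ccontr)
  assume np: "\<not> prime n"
  have "\<not> 4 dvd n"
  proof
    assume "4 dvd n"
    then have "4 dvd 4 * (fact (n - 3) :: nat) + 2" using dvd by (rule dvd_trans)
    then have "4 dvd (2 :: nat)" by (subst (asm) dvd_add_right_iff) auto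
    then show False by (auto dest: dvd_imp_le)
  qed
  have eq2: "p = 2" if p: "prime p" "p dvd n" for p
  proof -
    obtain k where k: "n = p * k" using p by blast
    have "k \<noteq> 0" "k \<noteq> 1" using k np p assms by auto
    then have "2 \<le> k" by simp
    have "p \<ge> 2" using p by (simp add: prime_ge_2_nat)
    have "p \<le> n - 3"
    \<comment> \<open>For \<open>p = 2\<close> the value \<open>k = 2\<close> would give
      \<open>n = 4\<close>, so \<open>k \<ge> 3\<close> and \<open>n \<ge> 6\<close>. For
      \<open>p \<ge> 3\<close>, \<open>2 * p \<le> n\<close> gives
      \<open>p \<le> n - p \<le> n - 3\<close>.\<close>
    proof (cases "p = 2")
      case True
      then show ?thesis using k \<open>2 \<le> k\<close> \<open>\<not> 4 dvd n\<close> by (cases "k = 2") auto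
    next
      case False
      moreover have "p * 2 \<le> n" using k \<open>2 \<le> k\<close> by simp
      ultimately show ?thesis using \<open>p \<ge> 2\<close> by linarith
    qed
    then have "p dvd fact (n - 3)" using \<open>p \<ge> 2\<close> by (intro dvd_fact) auto
    moreover have "p dvd 4 * fact (n - 3) + 2" using p dvd by (metis dvd_trans)
    ultimately have "p dvd 2" by (metis dvd_add_right_iff dvd_mult)
    then show ?thesis using \<open>p \<ge> 2\<close> by (auto dest: dvd_imp_le)
  qed
  \<comment> \<open>All prime factors being 2, \<open>n\<close> is even, and so is its half, which
    exceeds 1: this makes 4 a divisor of \<open>n\<close>.\<close>
  obtain p where p: "prime p" "p dvd n" using prime_factor_nat[of n] assms by auto
  then obtain k where k: "n = 2 * k" using eq2 by blast
  then have "k \<noteq> 1" using assms by auto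
  then obtain q where q: "prime q" "q dvd k" using prime_factor_nat by blast
  then have "q = 2" using eq2 k by simp
  then show False using q k \<open>\<not> 4 dvd n\<close> by auto
qed

lemma prime_iff_dvd_four_fact:
  fixes n :: nat
  assumes "3 \<le> n"
  shows "prime n \<longleftrightarrow> n dvd 4 * fact (n - 3) + 2 + n"
  using prime_dvd_four_fact[OF _ assms] prime_if_dvd_four_fact[OF assms]
  by (metis dvd_add_left_iff dvd_refl)

lemma odd_prime_iff_not_dvd_four_fact:
  fixes m :: nat
  assumes "odd m" "5 \<le> m" "m \<noteq> 9"
  shows "prime m \<longleftrightarrow> \<not> m dvd 4 * fact (m - 5) + m"
proof
  assume m: "prime m"
  \<comment> \<open>A prime divides a factorial only if it is at most the argument.\<close>
  have "\<not> m dvd fact (m - 5)"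
    using m assms by (simp add: prime_dvd_fact_iff)
  moreover have "\<not> m dvd 4" using assms by (auto dest: dvd_imp_le)
  ultimately show "\<not> m dvd 4 * fact (m - 5) + m"
    using m by (simp add: prime_dvd_mult_iff)
next
  assume "\<not> m dvd 4 * fact (m - 5) + m"
  then have "\<not> m dvd fact (m - 5)" by auto
  then show "prime m" using odd_composite_dvd_fact[of m] assms by linarith
qed

theorem theorem2:
  shows "(\<forall>n::nat. n \<ge> 3 \<and> n \<noteq> 7 \<longrightarrow>
            ((prime n \<and> prime (n + 2)) \<longleftrightarrow>
             (n dvd 4 * fact (n - 3) + 2 + n \<and> \<not> (n + 2) dvd 4 * fact (n - 3) + 2 + n)))
         \<and> \<not> ((prime (7::nat) \<and> prime (7 + 2 :: nat)) \<longleftrightarrow>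
              ((7::nat) dvd 4 * fact (7 - 3) + 2 + 7 \<and> \<not> (7 + 2 :: nat) dvd 4 * fact (7 - 3) + 2 + 7))
         \<and> (7::nat) dvd 4 * fact (7 - 3) + 2 + 7
         \<and> \<not> (7 + 2 :: nat) dvd 4 * fact (7 - 3) + 2 + 7
         \<and> \<not> prime (7 + 2 :: nat)"
proof -
  have "(prime n \<and> prime (n + 2)) \<longleftrightarrow>
      (n dvd 4 * fact (n - 3) + 2 + n \<and> \<not> (n + 2) dvd 4 * fact (n - 3) + 2 + n)"
    if n: "3 \<le> n" "n \<noteq> 7" for n :: nat
  proof -
    \<comment> \<open>Primality of \<open>n\<close> makes \<open>n + 2\<close> odd, and
      \<open>n \<noteq> 7\<close> excludes the exceptional value 9.\<close>
    have "prime (n + 2) \<longleftrightarrow> \<not> n + 2 dvd 4 * fact (n - 3) + 2 + n" if "prime n"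
    proof -
      have "odd n" using that n by (intro prime_odd_nat) auto
      moreover have "n + 2 - 5 = n - 3" by simp
      ultimately show ?thesis
        using odd_prime_iff_not_dvd_four_fact[of "n + 2"] n by (simp add: ac_simps)
    qed
    then show ?thesis using prime_iff_dvd_four_fact[OF n(1)] by blast
  qed
  moreover have "\<not> prime (9 :: nat)"
  proof
    assume "prime (9 :: nat)"
    then have "prime (3 * 3 :: nat)" by simp
    then show False using prime_product by fastforce
  qed
  \<comment> \<open>For \<open>n = 7\<close> the number is
    \<open>4 * 24 + 2 + 7 = 105\<close>.\<close>
  moreover have "(7::nat) dvd 105" "\<not> (9::nat) dvd 105" by simp_all
  ultimately show ?thesis by (simp add: fact_numeral)
qed

end
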